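(* Let $\rho_B=\tfrac12(\mathbb I+\boldsymbol b\cdot\boldsymbol\sigma)$ be a qubit state with $\boldsymbol b\ne0$, $\boldsymbol n_B=\boldsymbol b/|\boldsymbol b|$, and reference basis $\{|a_i\rangle\}$ the eigenbasis of $\rho_B$. If $\mathcal N_{KD}(\rho_B)=0$, then $Q_{ik}(\rho_B)$ is real and non-negative for the reference basis $\{|a_i\rangle\}$ paired with every second orthonormal basis $\{|b_k\rangle\}$. Consequently, a weak measurement of $A=\boldsymbol n_B\cdot\boldsymbol\sigma$ on $\rho_B$, followed by projective postselection in any orthonormal basis, never yields an anomalous weak value.
   Context: For orthonormal qubit bases $\{|a_i\rangle\}$, $\{|b_k\rangle\}$, the Kirkwood-Dirac quasiprobabilities of a state $\rho$ are $Q_{ik}(\rho)=\langle b_k|a_i\rangle\langle a_i|\rho|b_k\rangle=\mathrm{Tr}(|b_k\rangle\langle b_k|\,|a_i\rangle\langle a_i|\,\rho)$. With $\{|a_i\rangle\}$ fixed as the reference basis, $\mathcal N_{KD}(\rho)=\max_{\{|b_k\rangle\}}\tfrac12\big(\sum_{i,k}|Q_{ik}(\rho)|-1\big)$, the maximum over all orthonormal qubit bases. The weak value of an observable $A$ in state $\rho$ with postselection on the projector $\Pi_b$ (with $\mathrm{Tr}[\Pi_b\rho]\neq0$) is $A_w(b)=\mathrm{Tr}[\Pi_bA\rho]/\mathrm{Tr}[\Pi_b\rho]$. It is called anomalous if it has nonzero imaginary part or lies outside the range of the spectrum of $A$, i.e. outside the interval spanned by the eigenvalues (here $[-1,1]$).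 *)

theory Defs
  imports "HOL-Analysis.Analysis"
begin

text \<open>Dirac notation: \<open>braket u v\<close> is \<open>\<langle>u|v\<rangle>\<close>, conjugate-linear in \<open>u\<close>;
  \<open>ketbra u v\<close> is \<open>|u\<rangle>\<langle>v|\<close>.\<close>

definition braket :: "complex^'n \<Rightarrow> complex^'n \<Rightarrow> complex" where
  "braket u v = (\<Sum>j\<in>UNIV. cnj (u $ j) * v $ j)"

definition ketbra :: "complex^'n \<Rightarrow> complex^'n \<Rightarrow> complex^'n^'n" where
  "ketbra u v = (\<chi> i j. u $ i * cnj (v $ j))"

text \<open>Vectors indexed by the coordinate type are as many as the dimension, so an orthonormal
  family of this kind spans the space.\<close>

definition orthonormal_basis :: "('n \<Rightarrow> complex^'n) \<Rightarrow> bool" where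
  "orthonormal_basis e \<longleftrightarrow> (\<forall>i j. braket (e i) (e j) = (if i = j then 1 else 0))"

definition hermitian :: "complex^'n^'n \<Rightarrow> bool" where
  "hermitian M \<longleftrightarrow> (\<forall>i j. M $ i $ j = cnj (M $ j $ i))"

definition density_operator :: "complex^'n^'n \<Rightarrow> bool" where
  "density_operator \<rho> \<longleftrightarrow>
     hermitian \<rho> \<and> (\<forall>v. 0 \<le> Re (braket v (\<rho> *v v))) \<and> trace \<rho> = 1"

definition eigenvalue :: "complex^'n^'n \<Rightarrow> complex \<Rightarrow> bool" where
  "eigenvalue M l \<longleftrightarrow> (\<exists>v. v \<noteq> 0 \<and> M *v v = l *s v)"

definition eigenbasis :: "complex^'n^'n \<Rightarrow> ('n \<Rightarrow> complex^'n) \<Rightarrow> bool" where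
  "eigenbasis M e \<longleftrightarrow> orthonormal_basis e \<and> (\<forall>i. \<exists>l. M *v e i = l *s e i)"

definition pauli_x :: "complex^2^2" where
  "pauli_x = vector [vector [0, 1], vector [1, 0]]"

definition pauli_y :: "complex^2^2" where
  "pauli_y = vector [vector [0, - \<i>], vector [\<i>, 0]]"

definition pauli_z :: "complex^2^2" where
  "pauli_z = vector [vector [1, 0], vector [0, - 1]]"

definition pauli_dot :: "real^3 \<Rightarrow> complex^2^2" where
  "pauli_dot v = v $ 1 *\<^sub>R pauli_x + v $ 2 *\<^sub>R pauli_y + v $ 3 *\<^sub>R pauli_z"

definition bloch_operator :: "real^3 \<Rightarrow> complex^2^2" where
  "bloch_operator v = (1 / 2) *\<^sub>R (mat 1 + pauli_dot v)"

definition kd_quasiprob ::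
  "(2 \<Rightarrow> complex^2) \<Rightarrow> (2 \<Rightarrow> complex^2) \<Rightarrow> complex^2^2 \<Rightarrow> 2 \<Rightarrow> 2 \<Rightarrow> complex" where
  "kd_quasiprob a e \<rho> i k = braket (e k) (a i) * braket (a i) (\<rho> *v e k)"

definition kd_excess ::
  "(2 \<Rightarrow> complex^2) \<Rightarrow> (2 \<Rightarrow> complex^2) \<Rightarrow> complex^2^2 \<Rightarrow> real" where
  "kd_excess a e \<rho> =
     1 / 2 * ((\<Sum>i\<in>UNIV. \<Sum>k\<in>UNIV. cmod (kd_quasiprob a e \<rho> i k)) - 1)"

text \<open>The maximum over all orthonormal bases, for a fixed reference basis \<open>a\<close>;
  \<open>kd_nonclassicality_is_max\<close> below shows that it exists.\<close>

definition kd_nonclassicality :: "(2 \<Rightarrow> complex^2) \<Rightarrow> complex^2^2 \<Rightarrow> real" where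
  "kd_nonclassicality a \<rho> =
     (GREATEST x. \<exists>e. orthonormal_basis e \<and> x = kd_excess a e \<rho>)"

definition weak_value :: "complex^'n^'n \<Rightarrow> complex^'n^'n \<Rightarrow> complex^'n^'n \<Rightarrow> complex" where
  "weak_value A \<rho> P = trace (P ** A ** \<rho>) / trace (P ** \<rho>)"

text \<open>Meant for hermitian \<open>A\<close>, whose eigenvalues are real; the convex hull is then the interval
  from the smallest to the largest eigenvalue.\<close>

definition anomalous :: "complex^'n^'n \<Rightarrow> complex \<Rightarrow> bool" where
  "anomalous A w \<longleftrightarrow>
     Im w \<noteq> 0 \<or> Re w \<notin> convex hull {x. eigenvalue A (complex_of_real x)}"

lemma kd_quasiprob_eq_trace:
  "kd_quasiprob a e \<rho> i k = trace (ketbra (e k) (e k) ** ketbra (a i) (a i) ** \<rho>)"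
  by (simp add: kd_quasiprob_def braket_def ketbra_def trace_def matrix_matrix_mult_def
      matrix_vector_mult_def sum_2 algebra_simps)

lemma compact_orthonormal_bases:
  "compact {B :: complex^'n^'n. orthonormal_basis (\<lambda>k. B $ k)}"
proof -
  have "closed {B :: complex^'n^'n. orthonormal_basis (\<lambda>k. B $ k)}"
    unfolding orthonormal_basis_def braket_def
    by (intro closed_Collect_all closed_Collect_eq continuous_intros)
  moreover have "norm B \<le> real CARD('n)" if "orthonormal_basis (\<lambda>k. B $ k)" for B :: "complex^'n^'n"
  proof -
    have "norm (B $ i) = 1" for i
    proof -
      have "complex_of_real (\<Sum>j\<in>UNIV. (cmod (B $ i $ j))\<^sup>2) = braket (B $ i) (B $ i)"
        by (simp add: braket_def complex_norm_square mult.commute del: of_real_power)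
      also have "\<dots> = 1"
        using that by (simp add: orthonormal_basis_def)
      finally show ?thesis
        unfolding norm_vec_def L2_set_def using of_real_eq_1_iff by fastforce
    qed
    then show ?thesis
      using L2_set_le_sum[of UNIV "\<lambda>i. norm (B $ i)"] by (simp add: norm_vec_def)
  qed
  ultimately show ?thesis
    by (auto simp: compact_eq_bounded_closed bounded_iff)
qed

lemma kd_nonclassicality_is_max:
  shows "\<exists>e. orthonormal_basis e \<and> kd_nonclassicality a \<rho> = kd_excess a e \<rho>"
    and "orthonormal_basis e \<Longrightarrow> kd_excess a e \<rho> \<le> kd_nonclassicality a \<rho>"
proof -
  let ?S = "{B :: complex^2^2. orthonormal_basis (\<lambda>k. B $ k)}"
  let ?f = "\<lambda>B :: complex^2^2. kd_excess a (\<lambda>k. B $ k) \<rho>"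
  have "mat 1 \<in> ?S"
    by (auto simp: orthonormal_basis_def braket_def mat_def sum_2 forall_2)
  moreover have "continuous_on ?S ?f"
    unfolding kd_excess_def kd_quasiprob_def braket_def matrix_vector_mult_def
    by (simp, intro continuous_intros ballI) simp_all
  ultimately obtain B where B: "B \<in> ?S" "\<And>C. C \<in> ?S \<Longrightarrow> ?f C \<le> ?f B"
    using continuous_attains_sup[OF compact_orthonormal_bases, of ?f] by blast
  have ub: "kd_excess a e \<rho> \<le> ?f B" if "orthonormal_basis e" for e
  proof -
    have eq: "($) (vec_lambda e) = e"
      by (simp add: fun_eq_iff)
    show ?thesis
      using B(2)[of "vec_lambda e"] that by (simp add: eq)
  qed
  have "kd_nonclassicality a \<rho> = ?f B"
    unfolding kd_nonclassicality_def using B(1) ub by (intro Greatest_equality) auto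
  then show "\<exists>e. orthonormal_basis e \<and> kd_nonclassicality a \<rho> = kd_excess a e \<rho>"
    and "orthonormal_basis e \<Longrightarrow> kd_excess a e \<rho> \<le> kd_nonclassicality a \<rho>"
    using B(1) ub by auto
qed

end

theory Submission
  imports Defs "HOL-Library.Complex_Order"
begin

text \<open>In an eigenbasis \<open>a\<close> of \<open>\<rho>\<close> with eigenvalues \<open>l i \<ge> 0\<close> the quasiprobability is
  \<open>l i * |\<langle>a i|e k\<rangle>|\<^sup>2\<close>, which is non-negative for every basis \<open>e\<close>. Since \<open>2\<rho> = 1 + |b| A\<close>, the
  same basis diagonalises \<open>A\<close>, and inserting the resolution of the identity \<open>\<Sum>i. |a i\<rangle>\<langle>a i|\<close>
  between \<open>A\<close> and \<open>\<rho>\<close> displays the weak value as the mean of the eigenvalues of \<open>A\<close> with weights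
  proportional to the quasiprobabilities.\<close>

lemma cnj_braket: "cnj (braket u v) = braket v u"
  by (simp add: braket_def mult.commute)

lemma braket_scale_right: "braket u (c *s v) = c * braket u v"
  by (simp add: braket_def sum_distrib_left mult_ac)

lemma braket_scale_left: "braket (c *s u) v = cnj c * braket u v"
  by (simp add: braket_def sum_distrib_left mult_ac)

lemma braket_sum_right: "braket u (\<Sum>i\<in>I. f i) = (\<Sum>i\<in>I. braket u (f i))"
  unfolding braket_def sum_component sum_distrib_left by (rule sum.swap)

text \<open>Self-adjointness with respect to \<open>braket\<close>. It makes eigenvalues of a state
  real and lets the state act on a reference vector to its left.\<close>

lemma hermitian_braket:
  assumes "hermitian M"
  shows "braket u (M *v v) = braket (M *v u) v"
proof -
  have "braket u (M *v v) = (\<Sum>i\<in>UNIV. \<Sum>j\<in>UNIV. cnj (u $ i) * M $ i $ j * v $ j)"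
    by (simp add: braket_def matrix_vector_mult_def sum_distrib_left mult.assoc)
  also have "\<dots> = (\<Sum>j\<in>UNIV. \<Sum>i\<in>UNIV. cnj (u $ i) * M $ i $ j * v $ j)"
    by (rule sum.swap)
  also have "\<dots> = (\<Sum>j\<in>UNIV. \<Sum>i\<in>UNIV. cnj (M $ j $ i) * cnj (u $ i) * v $ j)"
    using assms unfolding hermitian_def by (intro sum.cong refl) (metis mult.commute)
  also have "\<dots> = braket (M *v u) v"
    by (simp add: braket_def matrix_vector_mult_def sum_distrib_right)
  finally show ?thesis .
qed

lemma trace_ketbra_mult: "trace (ketbra u v ** M) = braket v (M *v u)"
proof -
  have "trace (ketbra u v ** M) = (\<Sum>i\<in>UNIV. \<Sum>j\<in>UNIV. u $ i * cnj (v $ j) * M $ j $ i)"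
    by (simp add: trace_def matrix_matrix_mult_def ketbra_def)
  also have "\<dots> = (\<Sum>j\<in>UNIV. \<Sum>i\<in>UNIV. u $ i * cnj (v $ j) * M $ j $ i)"
    by (rule sum.swap)
  also have "\<dots> = braket v (M *v u)"
    by (simp add: braket_def matrix_vector_mult_def sum_distrib_left mult_ac)
  finally show ?thesis .
qed

lemma orthonormal_basis_nonzero: "orthonormal_basis a \<Longrightarrow> a i \<noteq> 0"
  by (metis braket_scale_right mult_zero_left orthonormal_basis_def vector_smult_lzero zero_neq_one)

text \<open>Orthonormality says that the matrix with rows \<open>cnj (a i)\<close> is a left inverse
  of the matrix with columns \<open>a i\<close>. For square matrices it is then a right inverse too,
  which is completeness.\<close>

lemma orthonormal_basis_expansion:
  fixes a :: "'n::finite \<Rightarrow> complex^'n"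
  assumes "orthonormal_basis a"
  shows "v = (\<Sum>i\<in>UNIV. braket (a i) v *s a i)"
proof -
  let ?B = "\<chi> i j. a j $ i" and ?C = "\<chi> i j. cnj (a i $ j)"
  have "?C ** ?B = mat 1"
    using assms
    by (simp add: orthonormal_basis_def braket_def matrix_matrix_mult_def mat_def vec_eq_iff)
  then have "?B ** ?C = mat 1"
    by (simp add: matrix_left_right_inverse)
  then have "v = ?B *v (?C *v v)"
    by (simp add: matrix_vector_mul_assoc)
  also have "?C *v v = (\<chi> i. braket (a i) v)"
    by (simp add: matrix_vector_mult_def braket_def)
  also have "?B *v \<dots> = (\<Sum>i\<in>UNIV. braket (a i) v *s a i)"
    by (simp add: matrix_vector_mult_def vec_eq_iff mult.commute)
  finally show ?thesis .
qed

text \<open>The eigenvalue is the expectation value of \<open>\<rho>\<close> in \<open>v\<close>.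
  The order is the one on complex numbers, so the conclusion also says that \<open>l\<close> is
  real.\<close>

lemma density_operator_eigenvalue_nonneg:
  assumes "density_operator \<rho>" and "braket v v = 1" and "\<rho> *v v = l *s v"
  shows "0 \<le> l"
proof -
  have "l = braket v (\<rho> *v v)"
    using assms by (simp add: braket_scale_right)
  then have "cnj l = l" and "0 \<le> Re l"
    using assms by (metis cnj_braket density_operator_def hermitian_braket)+
  then show ?thesis
    by (simp add: less_eq_complex_def complex_eq_iff)
qed

lemma kd_quasiprob_eigenbasis_nonneg:
  assumes "density_operator \<rho>" and "eigenbasis \<rho> a"
  shows "0 \<le> kd_quasiprob a e \<rho> i k"
proof -
  obtain l where l: "\<rho> *v a i = l *s a i"
    using assms by (auto simp: eigenbasis_def)
  have "braket (a i) (a i) = 1"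
    using assms by (simp add: eigenbasis_def orthonormal_basis_def)
  with assms(1) l have "0 \<le> l"
    by (intro density_operator_eigenvalue_nonneg)
  \<comment> \<open>Moving \<open>\<rho>\<close> to the left factor \<open>a i\<close> produces
    \<open>cnj l\<close>; the two overlaps left over are conjugate to each other.\<close>
  have "kd_quasiprob a e \<rho> i k = cnj l * (braket (e k) (a i) * cnj (braket (e k) (a i)))"
    using assms(1) l
    by (simp add: kd_quasiprob_def density_operator_def hermitian_braket braket_scale_left
        cnj_braket mult_ac)
  with \<open>0 \<le> l\<close> show ?thesis
    by (simp add: less_eq_complex_def complex_mult_cnj)
qed

text \<open>Expanding \<open>\<rho> *v e k\<close> in the basis \<open>a\<close> makes
  \<open>A\<close> act diagonally. With general \<open>A\<close> and complex \<open>s\<close>, this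
  serves both numerator and denominator of the weak value.\<close>

lemma trace_postselection_eq_sum_kd_quasiprob:
  assumes "orthonormal_basis a" and "\<And>i. A *v a i = s i *s a i"
  shows "trace (ketbra (e k) (e k) ** A ** \<rho>) = (\<Sum>i\<in>UNIV. s i * kd_quasiprob a e \<rho> i k)"
proof -
  have "trace (ketbra (e k) (e k) ** A ** \<rho>) = braket (e k) (A *v (\<rho> *v e k))"
    by (simp add: trace_ketbra_mult matrix_vector_mul_assoc flip: matrix_mul_assoc)
  also have "A *v (\<rho> *v e k) = A *v (\<Sum>i\<in>UNIV. braket (a i) (\<rho> *v e k) *s a i)"
    using orthonormal_basis_expansion[OF assms(1)] by metis
  also have "\<dots> = (\<Sum>i\<in>UNIV. (braket (a i) (\<rho> *v e k) * s i) *s a i)"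
    by (simp add: vec.linear_sum[OF matrix_vector_mul_linear_gen]
        vec.linear_scale[OF matrix_vector_mul_linear_gen] assms(2) vector_smult_assoc)
  also have "braket (e k) \<dots> = (\<Sum>i\<in>UNIV. s i * kd_quasiprob a e \<rho> i k)"
    by (simp add: braket_sum_right braket_scale_right kd_quasiprob_def mult_ac)
  finally show ?thesis .
qed

lemma not_anomalous_if_kd_quasiprob_nonneg:
  assumes a: "orthonormal_basis a"
    and A: "\<And>i. A *v a i = complex_of_real (s i) *s a i"
    and Q: "\<And>i. 0 \<le> kd_quasiprob a e \<rho> i k"
    and nz: "trace (ketbra (e k) (e k) ** \<rho>) \<noteq> 0"
  shows "\<not> anomalous A (weak_value A \<rho> (ketbra (e k) (e k)))"
proof -
  define q where "q i = Re (kd_quasiprob a e \<rho> i k)" for i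
  have q: "kd_quasiprob a e \<rho> i k = of_real (q i)" "0 \<le> q i" for i
    using Q[of i] by (simp_all add: q_def less_eq_complex_def complex_eq_iff)
  \<comment> \<open>The identity as observable, all eigenvalues 1, shows that the postselection
    probability is the total weight \<open>sum q UNIV\<close>.\<close>
  have "trace (ketbra (e k) (e k) ** mat 1 ** \<rho>) = (\<Sum>i\<in>UNIV. 1 * kd_quasiprob a e \<rho> i k)"
    by (rule trace_postselection_eq_sum_kd_quasiprob[OF a]) simp
  then have den: "trace (ketbra (e k) (e k) ** \<rho>) = of_real (sum q UNIV)"
    by (simp add: q(1))
  have num: "trace (ketbra (e k) (e k) ** A ** \<rho>) = of_real (\<Sum>i\<in>UNIV. s i * q i)"
    by (simp add: trace_postselection_eq_sum_kd_quasiprob[OF a A] q(1))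
  have w: "weak_value A \<rho> (ketbra (e k) (e k))
      = of_real (\<Sum>i\<in>UNIV. (q i / sum q UNIV) *\<^sub>R s i)"
    unfolding weak_value_def num den
    by (simp add: sum_divide_distrib mult.commute)
  have "(\<Sum>i\<in>UNIV. (q i / sum q UNIV) *\<^sub>R s i)
      \<in> convex hull {x. eigenvalue A (complex_of_real x)}"
  proof (rule convex_sum)
    \<comment> \<open>Nonzero postselection probability is what allows the weights to be
      normalised.\<close>
    show "(\<Sum>i\<in>UNIV. q i / sum q UNIV) = 1"
      using nz unfolding den of_real_eq_0_iff by (simp flip: sum_divide_distrib)
    show "s i \<in> convex hull {x. eigenvalue A (complex_of_real x)}" for i
      using A orthonormal_basis_nonzero[OF a] by (intro hull_inc) (auto simp: eigenvalue_def)
  qed (simp_all add: q(2) sum_nonneg)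
  then show ?thesis
    unfolding anomalous_def w by simp
qed

lemma scaleR_matrix_mult_vector: "(c *\<^sub>R M) *v v = c *\<^sub>R (M *v v)"
  for M :: "complex^'m^'n"
  by (simp add: matrix_vector_mult_def vec_eq_iff scaleR_sum_right)

lemma pauli_dot_scaleR: "pauli_dot (c *\<^sub>R v) = c *\<^sub>R pauli_dot v"
  by (simp add: pauli_dot_def scaleR_right_distrib)

text \<open>\<open>pauli_dot b\<close> is an affine function of the Bloch operator, so it has the
  same eigenvectors, with \<open>l\<close> replaced by \<open>2 * l - 1\<close>. At
  \<open>b = 0\<close> both sides vanish, since division by zero gives zero.\<close>

lemma pauli_dot_eigenvector:
  assumes "bloch_operator b *v v = l *s v"
  shows "pauli_dot (b /\<^sub>R norm b) *v v = ((2 * l - 1) / complex_of_real (norm b)) *s v"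
proof -
  have "pauli_dot b = 2 *\<^sub>R bloch_operator b - mat 1"
    by (simp add: bloch_operator_def)
  then have "pauli_dot b *v v = 2 *\<^sub>R (l *s v) - v"
    by (simp only: matrix_vector_mult_diff_rdistrib scaleR_matrix_mult_vector
        matrix_vector_mul_lid assms)
  also have "\<dots> = (2 * l - 1) *s v"
    by (simp add: vec_eq_iff algebra_simps scaleR_conv_of_real)
  finally have "pauli_dot (b /\<^sub>R norm b) *v v = (1 / norm b) *\<^sub>R ((2 * l - 1) *s v)"
    by (simp only: pauli_dot_scaleR scaleR_matrix_mult_vector inverse_eq_divide)
  also have "\<dots> = ((2 * l - 1) / complex_of_real (norm b)) *s v"
    by (simp add: vec_eq_iff scaleR_conv_of_real[where 'a = complex] left_diff_distrib)
  finally show ?thesis .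
qed

theorem proposition4:
  fixes b :: "real^3" and a :: "2 \<Rightarrow> complex^2"
  assumes "density_operator (bloch_operator b)"
    and "b \<noteq> 0"
    and "eigenbasis (bloch_operator b) a"
    and "kd_nonclassicality a (bloch_operator b) = 0"
  shows "(\<forall>e. orthonormal_basis e \<longrightarrow>
            (\<forall>i k. kd_quasiprob a e (bloch_operator b) i k \<in> \<real> \<and>
                   0 \<le> Re (kd_quasiprob a e (bloch_operator b) i k))) \<and>
         (\<forall>e k. orthonormal_basis e \<longrightarrow>
            trace (ketbra (e k) (e k) ** bloch_operator b) \<noteq> 0 \<longrightarrow>
            \<not> anomalous (pauli_dot (b /\<^sub>R norm b))
                (weak_value (pauli_dot (b /\<^sub>R norm b)) (bloch_operator b) (ketbra (e k) (e k))))"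
proof (intro conjI allI impI)
  let ?\<rho> = "bloch_operator b"
  have Q: "0 \<le> kd_quasiprob a e ?\<rho> i k" for e i k
    using assms by (intro kd_quasiprob_eigenbasis_nonneg)
  show "kd_quasiprob a e ?\<rho> i k \<in> \<real>" "0 \<le> Re (kd_quasiprob a e ?\<rho> i k)" for e i k
    using Q[of e i k] by (simp_all add: less_eq_complex_def complex_is_Real_iff)
  fix e :: "2 \<Rightarrow> complex^2" and k
  assume nz: "trace (ketbra (e k) (e k) ** ?\<rho>) \<noteq> 0"
  have a: "orthonormal_basis a"
    using assms by (simp add: eigenbasis_def)
  have "\<exists>s. pauli_dot (b /\<^sub>R norm b) *v a i = complex_of_real s *s a i" for i
  proof -
    obtain l where l: "?\<rho> *v a i = l *s a i"
      using assms by (auto simp: eigenbasis_def)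
    \<comment> \<open>Used here for the reality of \<open>l\<close>: the convex hull argument
      requires real eigenvalues of the observable.\<close>
    have "0 \<le> l"
      using assms a l
      by (intro density_operator_eigenvalue_nonneg) (auto simp: orthonormal_basis_def)
    then obtain r where "l = of_real r"
      by (metis nonnegative_complex_is_real Reals_cases)
    then have "(2 * l - 1) / of_real (norm b) = of_real ((2 * r - 1) / norm b)"
      by simp
    with pauli_dot_eigenvector[OF l] show ?thesis
      by metis
  qed
  then obtain s where "\<And>i. pauli_dot (b /\<^sub>R norm b) *v a i = complex_of_real (s i) *s a i"
    by metis
  with a Q nz show "\<not> anomalous (pauli_dot (b /\<^sub>R norm b))
      (weak_value (pauli_dot (b /\<^sub>R norm b)) ?\<rho> (ketbra (e k) (e k)))"
    by (intro not_anomalous_if_kd_quasiprob_nonneg)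
qed

end
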